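(* Let $\mathfrak{A},\mathfrak{B}$ be separable unital $C^*$-algebras, let $K\subset\mathfrak{A}$ and $L\subset\mathfrak{B}$ be compact sets generating $\mathfrak{A}$ and $\mathfrak{B}$ respectively, and let $\alpha:\mathfrak{A}\to\mathfrak{B}$ be a unital $*$-homomorphism. Then $\omega^{K,L}_\alpha=\tilde{\omega}^{K,L}_\alpha$.
   Context: A set $K\subset\mathfrak{A}$ generates the unital $C^*$-algebra $\mathfrak{A}$ if the smallest $C^*$-subalgebra of $\mathfrak{A}$ containing $K\cup\{1\}$ is $\mathfrak{A}$. $\operatorname{Rep}(\mathfrak{A})$ denotes the set of all unital $*$-representations $\pi:\mathfrak{A}\to B(\ell^2)$, with the metric $d_K(\pi,\pi')=\sup_{x\in K}\|\pi(x)-\pi'(x)\|$; similarly for $\mathfrak{B}$ and $L$. $\Omega$ is the set of all continuous, concave, nondecreasing functions $\omega:[0,\infty)\to[0,\infty)$ with $\omega(0)=0$ (concavity in the weak sense). For $a\in\mathfrak{A}$ and $t\ge 0$ put $f^K_a(t)=\sup\{\|\pi(a)-\pi'(a)\|:\pi,\pi'\in\operatorname{Rep}(\mathfrak{A}),\ d_K(\pi,\pi')\le t\}$ and $\omega^K_a(t)=\inf\{\omega(t):\omega\in\Omega,\ \omega\ge f^K_a\}$; the function $\omega^L_b$ for $b\in\mathfrak{B}$ is defined in the same way from $\operatorname{Rep}(\mathfrak{B})$ and $d_L$. The two functions in the claim are the pointwise infima $$\omega^{K,L}_\alpha(t)=\inf\{\omega(t):\omega\in\Omega,\ \omega^L_{\alpha(a)}\le\omega^K_a\circ\omega\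 \text{for all } a\in\mathfrak{A}\},$$ $$\tilde{\omega}^{K,L}_\alpha(t)=\inf\{\omega(t):\omega\in\Omega,\ d_K(\pi\circ\alpha,\pi'\circ\alpha)\le\omega(d_L(\pi,\pi'))\ \text{for all }\pi,\pi'\in\operatorname{Rep}(\mathfrak{B})\},$$ the latter being the minimal modulus of continuity of $\alpha^*:(\operatorname{Rep}(\mathfrak{B}),d_L)\to(\operatorname{Rep}(\mathfrak{A}),d_K)$, $\pi\mapsto\pi\circ\alpha$. Both sets over which infima are taken are nonempty. *)

theory Defs
  imports "HOL-Analysis.Analysis"
begin

section \<open>Unital C*-algebras\<close>

class scaleC =
  fixes scaleC :: "complex \<Rightarrow> 'a \<Rightarrow> 'a"  (infixr \<open>*\<^sub>C\<close> 75)

class star =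
  fixes star :: "'a \<Rightarrow> 'a"

text \<open>
  The class is not based on the class of unital real normed algebras of the library, which
  requires \<open>norm 1 = 1\<close> and hence excludes the zero algebra; for a nonzero algebra
  \<open>norm 1 = 1\<close> follows from the C*-identity.
\<close>

class unital_cstar_algebra = banach + real_normed_algebra + monoid_mult + scaleC + star +
  assumes scaleR_eq_scaleC: "r *\<^sub>R a = complex_of_real r *\<^sub>C a"
    and scaleC_add_right: "z *\<^sub>C (a + b) = z *\<^sub>C a + z *\<^sub>C b"
    and scaleC_add_left: "(z + w) *\<^sub>C a = z *\<^sub>C a + w *\<^sub>C a"
    and scaleC_scaleC: "z *\<^sub>C w *\<^sub>C a = (z * w) *\<^sub>C a"
    and mult_scaleC_left: "(z *\<^sub>C a) * b = z *\<^sub>C (a * b)"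
    and mult_scaleC_right: "a * (z *\<^sub>C b) = z *\<^sub>C (a * b)"
    and norm_scaleC: "norm (z *\<^sub>C a) = cmod z * norm a"
    and star_star: "star (star a) = a"
    and star_add: "star (a + b) = star a + star b"
    and star_scaleC: "star (z *\<^sub>C a) = cnj z *\<^sub>C star a"
    and star_mult: "star (a * b) = star b * star a"
    and cstar_identity: "norm (star a * a) = (norm a)\<^sup>2"

definition cstar_subalgebra :: "'a::unital_cstar_algebra set \<Rightarrow> bool" where
  "cstar_subalgebra S \<longleftrightarrow>
     closed S \<and> 0 \<in> S \<and>
     (\<forall>a\<in>S. \<forall>b\<in>S. a + b \<in> S \<and> a * b \<in> S) \<and>
     (\<forall>z. \<forall>a\<in>S. z *\<^sub>C a \<in> S) \<and>
     (\<forall>a\<in>S. star a \<in> S)"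

definition generates :: "'a::unital_cstar_algebra set \<Rightarrow> bool" where
  "generates K \<longleftrightarrow> cstar_subalgebra hull (insert 1 K) = UNIV"

definition unital_star_hom ::
    "('a::unital_cstar_algebra \<Rightarrow> 'b::unital_cstar_algebra) \<Rightarrow> bool" where
  "unital_star_hom \<alpha> \<longleftrightarrow>
     (\<forall>a b. \<alpha> (a + b) = \<alpha> a + \<alpha> b) \<and>
     (\<forall>z a. \<alpha> (z *\<^sub>C a) = z *\<^sub>C \<alpha> a) \<and>
     (\<forall>a b. \<alpha> (a * b) = \<alpha> a * \<alpha> b) \<and>
     (\<forall>a. \<alpha> (star a) = star (\<alpha> a)) \<and>
     \<alpha> 1 = 1"


section \<open>The Hilbert space of square-summable complex sequences\<close>

typedef ell2 = "{x :: nat \<Rightarrow> complex. summable (\<lambda>n. (cmod (x n))\<^sup>2)}"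
  morphisms ell2_nth Abs_ell2
  by (rule exI[of _ "\<lambda>_. 0"]) simp

setup_lifting type_definition_ell2

lemma summable_ell2: "summable (\<lambda>n. (cmod (ell2_nth x n))\<^sup>2)"
  using ell2_nth[of x] by simp

lemma summable_add_ell2:
  fixes x y :: "nat \<Rightarrow> complex"
  assumes "summable (\<lambda>n. (cmod (x n))\<^sup>2)" "summable (\<lambda>n. (cmod (y n))\<^sup>2)"
  shows "summable (\<lambda>n. (cmod (x n + y n))\<^sup>2)"
proof (rule summable_comparison_test'[of "\<lambda>n. 2 * ((cmod (x n))\<^sup>2 + (cmod (y n))\<^sup>2)" 0])
  show "summable (\<lambda>n. 2 * ((cmod (x n))\<^sup>2 + (cmod (y n))\<^sup>2))"
    by (intro summable_mult summable_add assms)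
  fix n
  have "(cmod (x n + y n))\<^sup>2 \<le> (cmod (x n) + cmod (y n))\<^sup>2"
    by (intro power_mono norm_triangle_ineq) simp
  also have "\<dots> \<le> 2 * ((cmod (x n))\<^sup>2 + (cmod (y n))\<^sup>2)"
    by (smt (verit) power2_diff power2_sum zero_le_power2)
  finally show "norm ((cmod (x n + y n))\<^sup>2) \<le> 2 * ((cmod (x n))\<^sup>2 + (cmod (y n))\<^sup>2)"
    by simp
qed

lemma summable_scale_ell2:
  fixes x :: "nat \<Rightarrow> complex"
  assumes "summable (\<lambda>n. (cmod (x n))\<^sup>2)"
  shows "summable (\<lambda>n. (cmod (z * x n))\<^sup>2)"
  using summable_mult[OF assms, of "(cmod z)\<^sup>2"] by (simp add: norm_mult power_mult_distrib)

definition cinner :: "ell2 \<Rightarrow> ell2 \<Rightarrow> complex" where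
  "cinner x y = (\<Sum>n. ell2_nth x n * cnj (ell2_nth y n))"

lemma summable_cinner: "summable (\<lambda>n. ell2_nth x n * cnj (ell2_nth y n))"
proof (rule summable_comparison_test'
    [of "\<lambda>n. (cmod (ell2_nth x n))\<^sup>2 + (cmod (ell2_nth y n))\<^sup>2" 0])
  show "summable (\<lambda>n. (cmod (ell2_nth x n))\<^sup>2 + (cmod (ell2_nth y n))\<^sup>2)"
    by (intro summable_add summable_ell2)
  fix n
  have "2 * (cmod (ell2_nth x n) * cmod (ell2_nth y n))
      \<le> (cmod (ell2_nth x n))\<^sup>2 + (cmod (ell2_nth y n))\<^sup>2"
    using sum_squares_bound[of "cmod (ell2_nth x n)" "cmod (ell2_nth y n)"] by simp
  moreover have "0 \<le> cmod (ell2_nth x n) * cmod (ell2_nth y n)" by simp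
  ultimately show "norm (ell2_nth x n * cnj (ell2_nth y n))
      \<le> (cmod (ell2_nth x n))\<^sup>2 + (cmod (ell2_nth y n))\<^sup>2"
    unfolding norm_mult complex_mod_cnj by linarith
qed

instantiation ell2 :: "{real_inner, scaleC}"
begin

lift_definition zero_ell2 :: ell2 is "\<lambda>_. 0" by simp

lift_definition plus_ell2 :: "ell2 \<Rightarrow> ell2 \<Rightarrow> ell2" is "\<lambda>x y n. x n + y n"
  by (rule summable_add_ell2)

lift_definition uminus_ell2 :: "ell2 \<Rightarrow> ell2" is "\<lambda>x n. - x n" by simp

lift_definition minus_ell2 :: "ell2 \<Rightarrow> ell2 \<Rightarrow> ell2" is "\<lambda>x y n. x n - y n"
  using summable_add_ell2[where y = "\<lambda>n. - y n" for y] by simp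

lift_definition scaleC_ell2 :: "complex \<Rightarrow> ell2 \<Rightarrow> ell2" is "\<lambda>z x n. z * x n"
  by (rule summable_scale_ell2)

lift_definition scaleR_ell2 :: "real \<Rightarrow> ell2 \<Rightarrow> ell2" is "\<lambda>r x n. complex_of_real r * x n"
  by (rule summable_scale_ell2)

definition inner_ell2 :: "ell2 \<Rightarrow> ell2 \<Rightarrow> real" where
  "inner_ell2 x y = Re (cinner x y)"

definition norm_ell2 :: "ell2 \<Rightarrow> real" where
  "norm_ell2 x = sqrt (\<Sum>n. (cmod (ell2_nth x n))\<^sup>2)"

definition sgn_ell2 :: "ell2 \<Rightarrow> ell2" where
  "sgn_ell2 x = inverse (norm x) *\<^sub>R x"

definition dist_ell2 :: "ell2 \<Rightarrow> ell2 \<Rightarrow> real" where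
  "dist_ell2 x y = norm (x - y)"

definition uniformity_ell2 :: "(ell2 \<times> ell2) filter" where
  "uniformity_ell2 = (INF e\<in>{0<..}. principal {(x, y). dist x y < e})"

definition open_ell2 :: "ell2 set \<Rightarrow> bool" where
  "open_ell2 U \<longleftrightarrow> (\<forall>x\<in>U. eventually (\<lambda>(x', y). x' = x \<longrightarrow> y \<in> U) uniformity)"

instance
proof
  fix x y z :: ell2 and r s :: real and U :: "ell2 set"
  show "x + y + z = x + (y + z)" by transfer (simp add: add.assoc)
  show "x + y = y + x" by transfer (simp add: add.commute)
  show "0 + x = x" by transfer simp
  show "- x + x = 0" by transfer simp
  show "x - y = x + - y" by transfer simp
  show "r *\<^sub>R (x + y) = r *\<^sub>R x + r *\<^sub>R y" by transfer (simp add: distrib_left)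
  show "(r + s) *\<^sub>R x = r *\<^sub>R x + s *\<^sub>R x" by transfer (simp add: distrib_right)
  show "r *\<^sub>R s *\<^sub>R x = (r * s) *\<^sub>R x" by transfer (simp add: mult.assoc)
  show "1 *\<^sub>R x = x" by transfer simp
  show "sgn x = inverse (norm x) *\<^sub>R x" by (rule sgn_ell2_def)
  show "dist x y = norm (x - y)" by (rule dist_ell2_def)
  show "(uniformity :: (ell2 \<times> ell2) filter) = (INF e\<in>{0<..}. principal {(x, y). dist x y < e})"
    by (rule uniformity_ell2_def)
  show "open U = (\<forall>x\<in>U. \<forall>\<^sub>F (x', y) in uniformity. x' = x \<longrightarrow> y \<in> U)"
    by (rule open_ell2_def)
  have Re_cinner: "inner u v = (\<Sum>n. Re (ell2_nth u n * cnj (ell2_nth v n)))" for u v :: ell2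
    unfolding inner_ell2_def cinner_def by (rule Re_suminf[OF summable_cinner])
  have self: "inner u u = (\<Sum>n. (cmod (ell2_nth u n))\<^sup>2)" for u :: ell2
    unfolding Re_cinner by (simp add: complex_mult_cnj cmod_power2)
  show "inner x y = inner y x"
    unfolding Re_cinner by (simp add: mult.commute)
  show "inner (x + y) z = inner x z + inner y z"
    unfolding Re_cinner plus_ell2.rep_eq distrib_right plus_complex.sel
    by (rule suminf_add[symmetric]) (intro summable_Re summable_cinner)+
  have "inner (r *\<^sub>R x) y = (\<Sum>n. r * Re (ell2_nth x n * cnj (ell2_nth y n)))"
    unfolding Re_cinner scaleR_ell2.rep_eq by (simp add: algebra_simps)
  also have "\<dots> = r * inner x y"
    unfolding Re_cinner by (rule suminf_mult) (intro summable_Re summable_cinner)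
  finally show "inner (r *\<^sub>R x) y = r * inner x y" .
  show "0 \<le> inner x x"
    unfolding self by (rule suminf_nonneg[OF summable_ell2]) simp
  have "inner x x = 0 \<longleftrightarrow> (\<forall>n. ell2_nth x n = 0)"
    unfolding self using suminf_eq_zero_iff[OF summable_ell2[of x]] by simp
  also have "\<dots> \<longleftrightarrow> x = 0" by transfer auto
  finally show "inner x x = 0 \<longleftrightarrow> x = 0" .
  show "norm x = sqrt (inner x x)" unfolding self norm_ell2_def ..
qed

end


section \<open>Representations on the Hilbert space\<close>

text \<open>
  Bounded operators on \<open>ell2\<close> are the complex-homogeneous elements of \<open>ell2 \<Rightarrow>\<^sub>L ell2\<close>,
  whose norm is the operator norm. The last conjunct says that \<open>\<pi> (star a)\<close> is the
  Hilbert space adjoint of \<open>\<pi> a\<close>.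
\<close>

definition Reps :: "('a::unital_cstar_algebra \<Rightarrow> ell2 \<Rightarrow>\<^sub>L ell2) set" where
  "Reps = {\<pi>.
     (\<forall>a z x. blinfun_apply (\<pi> a) (z *\<^sub>C x) = z *\<^sub>C blinfun_apply (\<pi> a) x) \<and>
     (\<forall>a b. \<pi> (a + b) = \<pi> a + \<pi> b) \<and>
     (\<forall>z a x. blinfun_apply (\<pi> (z *\<^sub>C a)) x = z *\<^sub>C blinfun_apply (\<pi> a) x) \<and>
     (\<forall>a b. \<pi> (a * b) = \<pi> a o\<^sub>L \<pi> b) \<and>
     \<pi> 1 = id_blinfun \<and>
     (\<forall>a x y. cinner (blinfun_apply (\<pi> (star a)) x) y = cinner x (blinfun_apply (\<pi> a) y))}"

text \<open>
  In this definition and in that of \<open>osc\<close>, \<open>insert 0\<close> makes the supremum of the empty set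
  equal to 0 and changes nothing otherwise: \<open>K\<close> may be empty (if the algebra consists of the
  scalars), and \<open>Reps\<close> is empty for the zero algebra.
\<close>

definition dist_rep :: "'a::unital_cstar_algebra set \<Rightarrow>
    ('a \<Rightarrow> ell2 \<Rightarrow>\<^sub>L ell2) \<Rightarrow> ('a \<Rightarrow> ell2 \<Rightarrow>\<^sub>L ell2) \<Rightarrow> real" where
  "dist_rep K \<pi> \<pi>' = Sup (insert 0 ((\<lambda>x. norm (\<pi> x - \<pi>' x)) ` K))"


section \<open>Moduli of continuity\<close>

text \<open>
  Functions on \<open>[0, \<infinity>)\<close> are represented by functions on \<open>real\<close> whose values at negative
  arguments are irrelevant.
\<close>

definition Omega :: "(real \<Rightarrow> real) set" where
  "Omega = {\<omega>. continuous_on {0..} \<omega> \<and> concave_on {0..} \<omega> \<and> mono_on {0..} \<omega> \<and>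
     \<omega> 0 = 0 \<and> (\<forall>t\<ge>0. 0 \<le> \<omega> t)}"

definition osc :: "'a::unital_cstar_algebra set \<Rightarrow> 'a \<Rightarrow> real \<Rightarrow> real" where
  "osc K a t =
     Sup (insert 0 {norm (\<pi> a - \<pi>' a) |\<pi> \<pi>'. \<pi> \<in> Reps \<and> \<pi>' \<in> Reps \<and> dist_rep K \<pi> \<pi>' \<le> t})"

definition omega_elem :: "'a::unital_cstar_algebra set \<Rightarrow> 'a \<Rightarrow> real \<Rightarrow> real" where
  "omega_elem K a t = Inf {\<omega> t |\<omega>. \<omega> \<in> Omega \<and> (\<forall>s\<ge>0. osc K a s \<le> \<omega> s)}"

definition omega_hom :: "'a::unital_cstar_algebra set \<Rightarrow> 'b::unital_cstar_algebra set \<Rightarrow>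
    ('a \<Rightarrow> 'b) \<Rightarrow> real \<Rightarrow> real" where
  "omega_hom K L \<alpha> t =
     Inf {\<omega> t |\<omega>. \<omega> \<in> Omega \<and>
       (\<forall>a. \<forall>s\<ge>0. omega_elem L (\<alpha> a) s \<le> omega_elem K a (\<omega> s))}"

definition omega_tilde_hom :: "'a::unital_cstar_algebra set \<Rightarrow> 'b::unital_cstar_algebra set \<Rightarrow>
    ('a \<Rightarrow> 'b) \<Rightarrow> real \<Rightarrow> real" where
  "omega_tilde_hom K L \<alpha> t =
     Inf {\<omega> t |\<omega>. \<omega> \<in> Omega \<and>
       (\<forall>\<pi>\<in>Reps. \<forall>\<pi>'\<in>Reps. dist_rep K (\<pi> \<circ> \<alpha>) (\<pi>' \<circ> \<alpha>) \<le> \<omega> (dist_rep L \<pi> \<pi>'))}"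

end

theory Submission
  imports Defs
begin

text \<open>
  The two infima are taken over the same set of functions, which is what is proved.

  Let \<open>\<omega>\<close> satisfy the condition on the functions \<open>omega_elem\<close>. For \<open>x \<in> K\<close> the oscillation of \<open>x\<close>
  at scale \<open>t\<close> is at most \<open>t\<close>, hence \<open>omega_elem K x\<close> lies below the identity (which belongs
  to \<open>Omega\<close>). So \<open>norm (\<pi> (\<alpha> x) - \<pi>' (\<alpha> x))\<close> is at most
  \<open>omega_elem L (\<alpha> x) d \<le> omega_elem K x (\<omega> d) \<le> \<omega> d\<close> for \<open>d = dist_rep L \<pi> \<pi>'\<close>, and the supremum
  over \<open>x \<in> K\<close> says that \<open>\<omega>\<close> is a modulus of continuity of \<open>\<pi> \<mapsto> \<pi> \<circ> \<alpha>\<close>. Conversely, if \<open>\<omega>\<close> is such a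
  modulus and \<open>\<omega>' \<in> Omega\<close> dominates the oscillation of \<open>a\<close>, then \<open>\<omega>' \<circ> \<omega>\<close> is in \<open>Omega\<close> and
  dominates the oscillation of \<open>\<alpha> a\<close>; taking the infimum over \<open>\<omega>'\<close> gives the condition on
  \<open>omega_elem\<close>.

  What has to be supplied is that the real suprema and infima involved are those of bounded,
  respectively nonempty, sets. Boundedness is the contractivity of representations
  (\<open>norm_Reps_le\<close>), proved with a Neumann series. Nonemptiness of the set of majorants
  of an oscillation (\<open>ex_Omega_majorant\<close>) is where the generation hypotheses enter: the elements \<open>a\<close>
  for which \<open>\<pi> \<mapsto> \<pi> a\<close> is uniformly continuous form a C*-subalgebra that contains \<open>K\<close> and \<open>1\<close>.
\<close>

section \<open>Representations are contractive\<close>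

lemma norm_scaleC_ell2: "norm (z *\<^sub>C x) = cmod z * norm (x::ell2)"
  unfolding norm_ell2_def scaleC_ell2.rep_eq norm_mult power_mult_distrib
  by (subst suminf_mult[OF summable_ell2]) (simp add: real_sqrt_mult)

lemma scaleR_eq_scaleC_ell2: "r *\<^sub>R x = complex_of_real r *\<^sub>C (x::ell2)"
  by transfer simp

lemma
  assumes "\<pi> \<in> Reps"
  shows Reps_add: "\<pi> (a + b) = \<pi> a + \<pi> b"
    and Reps_scaleC: "blinfun_apply (\<pi> (z *\<^sub>C a)) x = z *\<^sub>C blinfun_apply (\<pi> a) x"
    and Reps_mult: "\<pi> (a * b) = \<pi> a o\<^sub>L \<pi> b"
    and Reps_one: "\<pi> 1 = id_blinfun"
    and Reps_star: "inner (blinfun_apply (\<pi> (star a)) x) y = inner x (blinfun_apply (\<pi> a) y)"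
  using assms unfolding Reps_def inner_ell2_def by auto

lemma Reps_zero: "\<pi> \<in> Reps \<Longrightarrow> \<pi> 0 = 0"
  using Reps_add[of \<pi> 0 0] by simp

lemma Reps_diff: "\<pi> \<in> Reps \<Longrightarrow> \<pi> (a - b) = \<pi> a - \<pi> b"
  using Reps_add[of \<pi> "a - b" b] by simp

lemma Reps_scaleR: "\<pi> \<in> Reps \<Longrightarrow> \<pi> (r *\<^sub>R a) = r *\<^sub>R \<pi> a"
  by (rule blinfun_eqI) (simp add: scaleR_eq_scaleC Reps_scaleC scaleR_eq_scaleC_ell2 scaleR_blinfun.rep_eq)

lemma norm_adjoint_le:
  fixes S T :: "'h::real_inner \<Rightarrow>\<^sub>L 'h"
  assumes adj: "\<And>x y. inner (blinfun_apply S x) y = inner x (blinfun_apply T y)"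
  shows "norm S \<le> norm T"
proof (rule norm_blinfun_bound)
  fix x
  have "norm (S x) * norm (S x) = inner x (T (S x))"
    by (metis adj power2_norm_eq_inner power2_eq_square)
  also have "\<dots> \<le> norm x * norm (T (S x))" by (rule norm_cauchy_schwarz)
  also have "\<dots> \<le> norm x * (norm T * norm (S x))" by (intro mult_left_mono norm_blinfun) simp
  finally have "norm (S x) * norm (S x) \<le> (norm T * norm x) * norm (S x)" by (simp add: ac_simps)
  then show "norm (S x) \<le> norm T * norm x"
    by (cases "norm (S x) = 0") (auto dest: mult_right_le_imp_le)
qed simp

text \<open>
  The Neumann series. The norm of \<open>1\<close> is arbitrary here, so only the positive powers
  of \<open>u\<close> are bounded by those of \<open>norm u\<close>.
\<close>

lemma ex_left_inverse_one_minus: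
  fixes u :: "'a::{banach, real_normed_algebra, monoid_mult}"
  assumes u: "norm u < 1"
  shows "\<exists>b. b * (1 - u) = 1"
proof -
  have bound: "norm (u ^ Suc n) \<le> norm u ^ Suc n" for n
  proof (induction n)
    case (Suc n)
    have "norm (u ^ Suc (Suc n)) \<le> norm u * norm (u ^ Suc n)"
      by (metis norm_mult_ineq power_Suc)
    also have "\<dots> \<le> norm u * norm u ^ Suc n" by (intro mult_left_mono Suc) simp
    finally show ?case by simp
  qed simp
  have "summable (\<lambda>n. norm u ^ Suc n)"
    using u by (subst summable_Suc_iff) (simp add: summable_geometric)
  then have "summable (\<lambda>n. u ^ Suc n)"
    by (rule summable_comparison_test'[where N = 0]) (rule bound)
  then have sm: "summable (\<lambda>n. u ^ n)" by (subst (asm) summable_Suc_iff)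
  have "(\<Sum>n. u ^ n) * u = (\<Sum>n. u ^ Suc n)"
    using suminf_mult2[OF sm, of u] by (simp add: power_commutes)
  also have "\<dots> = (\<Sum>n. u ^ n) - 1" using suminf_split_head[OF sm] by simp
  finally have "(\<Sum>n. u ^ n) * (1 - u) = 1" by (simp add: right_diff_distrib)
  then show ?thesis ..
qed

text \<open>
  If \<open>s = norm (\<pi> a)\<close> exceeded \<open>norm a\<close>, then \<open>1 - star a * a / s\<^sup>2\<close> would be invertible, and so would its
  image under \<open>\<pi>\<close>. But that image is not bounded below: \<open>s\<^sup>2\<close> is an approximate eigenvalue of
  the positive operator \<open>\<pi> (star a * a)\<close>, with approximate eigenvectors those at which \<open>\<pi> a\<close> nearly
  attains its norm.
\<close>

lemma norm_Reps_le:
  assumes \<pi>: "\<pi> \<in> Reps"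
  shows "norm (\<pi> a) \<le> norm a"
proof (rule ccontr)
  define s where "s = norm (\<pi> a)"
  define u where "u = inverse (s\<^sup>2) *\<^sub>R (star a * a)"
  assume "\<not> norm (\<pi> a) \<le> norm a"
  then have less: "norm a < s" by (simp add: s_def)
  then have s: "s > 0" using norm_ge_zero[of a] by linarith
  have "norm u = (norm a)\<^sup>2 / s\<^sup>2" by (simp add: u_def cstar_identity divide_inverse)
  also have "\<dots> < 1" using less s by (simp add: power_strict_mono)
  finally obtain b where b: "b * (1 - u) = 1" using ex_left_inverse_one_minus by blast
  \<comment> \<open>A bound for \<open>norm (\<pi> b)\<close> that is nonzero, even at least \<open>1\<close>, so that \<open>1 - 1 / C\<^sup>2\<close> lies in \<open>[0, 1)\<close>.\<close>
  define C where "C = 1 + norm (\<pi> b)"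
  have C: "C \<ge> 1" by (simp add: C_def)
  have star_le: "norm (\<pi> (star a)) \<le> s"
    unfolding s_def by (rule norm_adjoint_le) (rule Reps_star[OF \<pi>])
  \<comment> \<open>Invertibility keeps \<open>\<pi> a\<close> away from its own norm by a fixed factor.\<close>
  have key: "(norm (\<pi> a x))\<^sup>2 \<le> (1 - 1 / C\<^sup>2) * s\<^sup>2 * (norm x)\<^sup>2" for x
  proof -
    define T where "T = \<pi> (star a * a)"
    define v where "v = x - inverse (s\<^sup>2) *\<^sub>R T x"
    have Tx: "T x = \<pi> (star a) (\<pi> a x)" by (simp add: T_def Reps_mult[OF \<pi>])
    have "\<pi> (1 - u) x = v"
      by (simp add: v_def T_def u_def Reps_diff[OF \<pi>] Reps_one[OF \<pi>] Reps_scaleR[OF \<pi>]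
          minus_blinfun.rep_eq scaleR_blinfun.rep_eq)
    moreover have "\<pi> b (\<pi> (1 - u) x) = x"
      using arg_cong[OF b, of "\<lambda>c. \<pi> c x"] by (simp add: Reps_mult[OF \<pi>] Reps_one[OF \<pi>])
    ultimately have "norm x \<le> norm (\<pi> b) * norm v" by (metis norm_blinfun)
    also have "\<dots> \<le> C * norm v" by (simp add: C_def mult_right_mono)
    finally have "(norm x)\<^sup>2 \<le> C\<^sup>2 * (norm v)\<^sup>2"
      by (metis norm_ge_zero power_mono power_mult_distrib)
    moreover have "(norm v)\<^sup>2 \<le> (norm x)\<^sup>2 - (norm (\<pi> a x))\<^sup>2 / s\<^sup>2"
    proof -
      have in1: "inner x (T x) = (norm (\<pi> a x))\<^sup>2"
        unfolding Tx by (metis Reps_star[OF \<pi>] inner_commute power2_norm_eq_inner)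
      have "norm (T x) \<le> norm (\<pi> (star a)) * norm (\<pi> a x)" unfolding Tx by (rule norm_blinfun)
      also have "\<dots> \<le> s * norm (\<pi> a x)" by (intro mult_right_mono star_le) simp
      finally have "(norm (T x))\<^sup>2 \<le> s\<^sup>2 * (norm (\<pi> a x))\<^sup>2"
        by (metis norm_ge_zero power_mono power_mult_distrib)
      then have "inverse (s\<^sup>2) * (inverse (s\<^sup>2) * (norm (T x))\<^sup>2)
          \<le> inverse (s\<^sup>2) * (inverse (s\<^sup>2) * (s\<^sup>2 * (norm (\<pi> a x))\<^sup>2))"
        by (intro mult_left_mono) auto
      also have "\<dots> = inverse (s\<^sup>2) * (norm (\<pi> a x))\<^sup>2" using s by simp
      finally have "inverse (s\<^sup>2) * (inverse (s\<^sup>2) * (norm (T x))\<^sup>2) \<le> inverse (s\<^sup>2) * (norm (\<pi> a x))\<^sup>2" .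
      moreover have "(norm v)\<^sup>2 = (norm x)\<^sup>2 - 2 * (inverse (s\<^sup>2) * (norm (\<pi> a x))\<^sup>2)
          + inverse (s\<^sup>2) * (inverse (s\<^sup>2) * (norm (T x))\<^sup>2)"
        unfolding power2_norm_eq_inner v_def in1[symmetric, unfolded power2_norm_eq_inner]
        by (simp add: inner_diff_left inner_diff_right inner_commute algebra_simps)
      ultimately show ?thesis by (simp add: divide_inverse mult.commute)
    qed
    ultimately have "(norm x)\<^sup>2 \<le> C\<^sup>2 * ((norm x)\<^sup>2 - (norm (\<pi> a x))\<^sup>2 / s\<^sup>2)"
      by (meson mult_left_mono order_trans zero_le_power2)
    then show ?thesis using s C by (simp add: field_simps)
  qed
  have c: "0 \<le> 1 - 1 / C\<^sup>2" using C by (simp add: power_increasing one_le_power)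
  have "norm (\<pi> a) \<le> sqrt ((1 - 1 / C\<^sup>2) * s\<^sup>2)"
  proof (rule norm_blinfun_bound)
    fix x
    have "norm (\<pi> a x) \<le> sqrt ((1 - 1 / C\<^sup>2) * s\<^sup>2 * (norm x)\<^sup>2)" by (rule real_le_rsqrt) (rule key)
    then show "norm (\<pi> a x) \<le> sqrt ((1 - 1 / C\<^sup>2) * s\<^sup>2) * norm x"
      by (simp add: real_sqrt_mult)
  qed (use c in simp)
  then have "s\<^sup>2 \<le> (1 - 1 / C\<^sup>2) * s\<^sup>2"
    unfolding s_def[symmetric] using s c
    by (metis less_eq_real_def mult_nonneg_nonneg power_mono real_sqrt_pow2 zero_le_power2)
  then show False using s C by (simp add: field_simps)
qed

section \<open>Distances and oscillations\<close>

lemma norm_Reps_diff_le: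
  assumes "\<pi> \<in> Reps" "\<pi>' \<in> Reps"
  shows "norm (\<pi> a - \<pi>' a) \<le> 2 * norm a"
  using norm_triangle_ineq4[of "\<pi> a" "\<pi>' a"] norm_Reps_le[OF assms(1), of a]
    norm_Reps_le[OF assms(2), of a] by linarith

lemma bdd_above_dist_rep:
  assumes "bounded K" "\<pi> \<in> Reps" "\<pi>' \<in> Reps"
  shows "bdd_above (insert 0 ((\<lambda>x. norm (\<pi> x - \<pi>' x)) ` K))"
proof -
  obtain B where "\<forall>x\<in>K. norm x \<le> B" using assms(1) by (auto simp: bounded_iff)
  then have "norm (\<pi> x - \<pi>' x) \<le> 2 * B" if "x \<in> K" for x
    using norm_Reps_diff_le[OF assms(2,3), of x] that by force
  then show ?thesis by (intro bdd_aboveI[of _ "max 0 (2 * B)"]) (auto simp: le_max_iff_disj)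
qed

lemma dist_rep_upper:
  assumes "bounded K" "\<pi> \<in> Reps" "\<pi>' \<in> Reps" "x \<in> K"
  shows "norm (\<pi> x - \<pi>' x) \<le> dist_rep K \<pi> \<pi>'"
  unfolding dist_rep_def using assms by (intro cSup_upper bdd_above_dist_rep) auto

lemma dist_rep_nonneg:
  assumes "bounded K" "\<pi> \<in> Reps" "\<pi>' \<in> Reps"
  shows "0 \<le> dist_rep K \<pi> \<pi>'"
  unfolding dist_rep_def using assms by (intro cSup_upper bdd_above_dist_rep) auto

lemma dist_rep_least:
  assumes "0 \<le> c" "\<And>x. x \<in> K \<Longrightarrow> norm (\<pi> x - \<pi>' x) \<le> c"
  shows "dist_rep K \<pi> \<pi>' \<le> c"
  unfolding dist_rep_def using assms by (intro cSup_least) auto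

lemma bdd_above_osc:
  "bdd_above (insert 0 {norm (\<pi> a - \<pi>' a) |\<pi> \<pi>'.
     \<pi> \<in> Reps \<and> \<pi>' \<in> Reps \<and> dist_rep K \<pi> \<pi>' \<le> t})"
  by (rule bdd_aboveI[of _ "2 * norm a"]) (auto intro: norm_Reps_diff_le)

lemma osc_nonneg: "0 \<le> osc K a t"
  unfolding osc_def by (intro cSup_upper bdd_above_osc) auto

lemma osc_upper:
  assumes "\<pi> \<in> Reps" "\<pi>' \<in> Reps" "dist_rep K \<pi> \<pi>' \<le> t"
  shows "norm (\<pi> a - \<pi>' a) \<le> osc K a t"
  unfolding osc_def using assms by (intro cSup_upper bdd_above_osc) auto

lemma osc_least:
  assumes "0 \<le> c"
    and "\<And>\<pi> \<pi>'. \<pi> \<in> Reps \<Longrightarrow> \<pi>' \<in> Reps \<Longrightarrow> dist_rep K \<pi> \<pi>' \<le> t \<Longrightarrow> norm (\<pi> a - \<pi>' a) \<le> c"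
  shows "osc K a t \<le> c"
  unfolding osc_def using assms by (intro cSup_least) auto

section \<open>Uniform continuity of the evaluation at an element\<close>

text \<open>
  As \<open>norm (\<pi> a - \<pi>' a) \<le> 2 * norm a\<close>, an affine bound with arbitrarily small constant term
  is the same as uniform continuity of \<open>\<pi> \<mapsto> \<pi> a\<close>. The affine form is preferred because such bounds
  can be added and scaled, and because it is already a concave majorant of the oscillation up to \<open>\<epsilon>\<close>.
\<close>

definition unif_cont_elem :: "'a::unital_cstar_algebra set \<Rightarrow> 'a \<Rightarrow> bool" where
  "unif_cont_elem K a \<longleftrightarrow> (\<forall>\<epsilon>>0. \<exists>m\<ge>0. \<forall>\<pi>\<in>Reps. \<forall>\<pi>'\<in>Reps.
     norm (\<pi> a - \<pi>' a) \<le> m * dist_rep K \<pi> \<pi>' + \<epsilon>)"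

lemma unif_cont_elemI:
  assumes "\<And>\<epsilon>. \<epsilon> > 0 \<Longrightarrow> \<exists>m\<ge>0. \<forall>\<pi>\<in>Reps. \<forall>\<pi>'\<in>Reps.
     norm (\<pi> a - \<pi>' a) \<le> m * dist_rep K \<pi> \<pi>' + \<epsilon>"
  shows "unif_cont_elem K a"
  using assms unfolding unif_cont_elem_def by blast

lemma unif_cont_elemE:
  assumes "unif_cont_elem K a" "\<epsilon> > 0"
  obtains m where "m \<ge> 0"
    "\<And>\<pi> \<pi>'. \<pi> \<in> Reps \<Longrightarrow> \<pi>' \<in> Reps \<Longrightarrow> norm (\<pi> a - \<pi>' a) \<le> m * dist_rep K \<pi> \<pi>' + \<epsilon>"
  using assms unfolding unif_cont_elem_def by blast

text \<open>
  Sums, products, scalar multiples and adjoints all satisfy such a Lipschitz estimate, for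
  products with constants \<open>norm b\<close> and \<open>norm a\<close> because representations are contractive.
\<close>

lemma unif_cont_elem_Lipschitz:
  assumes a: "unif_cont_elem K a" and b: "unif_cont_elem K b" and "0 \<le> p" "0 \<le> q"
    and le: "\<And>\<pi> \<pi>'. \<pi> \<in> Reps \<Longrightarrow> \<pi>' \<in> Reps \<Longrightarrow>
      norm (\<pi> c - \<pi>' c) \<le> p * norm (\<pi> a - \<pi>' a) + q * norm (\<pi> b - \<pi>' b)"
  shows "unif_cont_elem K c"
proof (rule unif_cont_elemI)
  fix \<epsilon> :: real assume "\<epsilon> > 0"
  define \<delta> where "\<delta> = \<epsilon> / (p + q + 1)"
  have \<delta>: "\<delta> > 0" "(p + q) * \<delta> \<le> \<epsilon>"
    using \<open>\<epsilon> > 0\<close> \<open>0 \<le> p\<close> \<open>0 \<le> q\<close> by (auto simp: \<delta>_def field_simps)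
  obtain m where m: "m \<ge> 0"
    "\<And>\<pi> \<pi>'. \<pi> \<in> Reps \<Longrightarrow> \<pi>' \<in> Reps \<Longrightarrow> norm (\<pi> a - \<pi>' a) \<le> m * dist_rep K \<pi> \<pi>' + \<delta>"
    by (rule unif_cont_elemE[OF a \<delta>(1)]) blast
  obtain n where n: "n \<ge> 0"
    "\<And>\<pi> \<pi>'. \<pi> \<in> Reps \<Longrightarrow> \<pi>' \<in> Reps \<Longrightarrow> norm (\<pi> b - \<pi>' b) \<le> n * dist_rep K \<pi> \<pi>' + \<delta>"
    by (rule unif_cont_elemE[OF b \<delta>(1)]) blast
  show "\<exists>m\<ge>0. \<forall>\<pi>\<in>Reps. \<forall>\<pi>'\<in>Reps. norm (\<pi> c - \<pi>' c) \<le> m * dist_rep K \<pi> \<pi>' + \<epsilon>"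
  proof (intro exI[of _ "p * m + q * n"] conjI ballI)
    show "0 \<le> p * m + q * n" using m n assms by simp
    fix \<pi> \<pi>' :: "'a \<Rightarrow> ell2 \<Rightarrow>\<^sub>L ell2" assume R: "\<pi> \<in> Reps" "\<pi>' \<in> Reps"
    have "norm (\<pi> c - \<pi>' c) \<le> p * norm (\<pi> a - \<pi>' a) + q * norm (\<pi> b - \<pi>' b)" by (rule le[OF R])
    also have "\<dots> \<le> p * (m * dist_rep K \<pi> \<pi>' + \<delta>) + q * (n * dist_rep K \<pi> \<pi>' + \<delta>)"
      using m(2)[OF R] n(2)[OF R] assms by (intro add_mono mult_left_mono) auto
    also have "\<dots> \<le> (p * m + q * n) * dist_rep K \<pi> \<pi>' + \<epsilon>" using \<delta>(2) by (simp add: algebra_simps)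
    finally show "norm (\<pi> c - \<pi>' c) \<le> (p * m + q * n) * dist_rep K \<pi> \<pi>' + \<epsilon>" .
  qed
qed

lemma cstar_subalgebra_unif_cont_elem: "cstar_subalgebra {a. unif_cont_elem K a}"
proof -
  note I = unif_cont_elem_Lipschitz
  have "closed {a. unif_cont_elem K a}"
  proof (subst closed_sequential_limits, safe)
    fix f a assume f: "\<forall>n. f n \<in> {a. unif_cont_elem K a}" and lim: "f \<longlonglongrightarrow> a"
    show "unif_cont_elem K a"
    proof (rule unif_cont_elemI)
      fix \<epsilon> :: real assume \<epsilon>: "\<epsilon> > 0"
      obtain n where n: "norm (f n - a) < \<epsilon> / 8"
        using LIMSEQ_D[OF lim, of "\<epsilon> / 8"] \<epsilon> by auto
      obtain m where m: "m \<ge> 0" "\<And>\<pi> \<pi>'. \<pi> \<in> Reps \<Longrightarrow> \<pi>' \<in> Reps \<Longrightarrow>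
          norm (\<pi> (f n) - \<pi>' (f n)) \<le> m * dist_rep K \<pi> \<pi>' + \<epsilon> / 2"
        using unif_cont_elemE[of K "f n" "\<epsilon> / 2"] f \<epsilon> by auto
      have "norm (\<pi> a - \<pi>' a) \<le> m * dist_rep K \<pi> \<pi>' + \<epsilon>" if R: "\<pi> \<in> Reps" "\<pi>' \<in> Reps" for \<pi> \<pi>'
      proof -
        have "\<pi> a - \<pi>' a = (\<pi> (f n) - \<pi>' (f n)) - (\<pi> (f n - a) - \<pi>' (f n - a))"
          by (simp add: Reps_diff R)
        then have "norm (\<pi> a - \<pi>' a) \<le> norm (\<pi> (f n) - \<pi>' (f n)) + norm (\<pi> (f n - a) - \<pi>' (f n - a))"
          by (metis norm_triangle_ineq4)
        then show ?thesis using m(2)[OF R] norm_Reps_diff_le[OF R, of "f n - a"] n \<epsilon> by linarith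
      qed
      with m(1) show "\<exists>m\<ge>0. \<forall>\<pi>\<in>Reps. \<forall>\<pi>'\<in>Reps. norm (\<pi> a - \<pi>' a) \<le> m * dist_rep K \<pi> \<pi>' + \<epsilon>"
        by blast
    qed
  qed
  moreover have "unif_cont_elem K 0"
    by (rule unif_cont_elemI) (auto simp: Reps_zero intro!: exI[of _ 0])
  moreover have "unif_cont_elem K (a + b)" if "unif_cont_elem K a" "unif_cont_elem K b" for a b
  proof (rule I[OF that, of 1 1])
    fix \<pi> \<pi>' :: "'a \<Rightarrow> ell2 \<Rightarrow>\<^sub>L ell2" assume R: "\<pi> \<in> Reps" "\<pi>' \<in> Reps"
    show "norm (\<pi> (a + b) - \<pi>' (a + b)) \<le> 1 * norm (\<pi> a - \<pi>' a) + 1 * norm (\<pi> b - \<pi>' b)"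
      by (simp add: Reps_add R add_diff_add norm_triangle_ineq)
  qed auto
  moreover have "unif_cont_elem K (a * b)" if "unif_cont_elem K a" "unif_cont_elem K b" for a b
  proof (rule I[OF that, of "norm b" "norm a"])
    fix \<pi> \<pi>' :: "'a \<Rightarrow> ell2 \<Rightarrow>\<^sub>L ell2" assume R: "\<pi> \<in> Reps" "\<pi>' \<in> Reps"
    have "\<pi> (a * b) - \<pi>' (a * b) = ((\<pi> a - \<pi>' a) o\<^sub>L \<pi> b) + (\<pi>' a o\<^sub>L (\<pi> b - \<pi>' b))"
      by (rule blinfun_eqI)
        (simp add: Reps_mult R minus_blinfun.rep_eq plus_blinfun.rep_eq blinfun.diff_right)
    then have "norm (\<pi> (a * b) - \<pi>' (a * b))
        \<le> norm ((\<pi> a - \<pi>' a) o\<^sub>L \<pi> b) + norm (\<pi>' a o\<^sub>L (\<pi> b - \<pi>' b))"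
      by (metis norm_triangle_ineq)
    also have "\<dots> \<le> norm (\<pi> a - \<pi>' a) * norm (\<pi> b) + norm (\<pi>' a) * norm (\<pi> b - \<pi>' b)"
      by (intro add_mono norm_blinfun_compose)
    also have "\<dots> \<le> norm (\<pi> a - \<pi>' a) * norm b + norm a * norm (\<pi> b - \<pi>' b)"
      by (intro add_mono mult_left_mono mult_right_mono norm_Reps_le R) auto
    finally show "norm (\<pi> (a * b) - \<pi>' (a * b))
        \<le> norm b * norm (\<pi> a - \<pi>' a) + norm a * norm (\<pi> b - \<pi>' b)"
      by (simp add: mult.commute)
  qed auto
  moreover have "unif_cont_elem K (z *\<^sub>C a)" if "unif_cont_elem K a" for a z
  proof (rule I[OF that that, of "cmod z" 0])
    fix \<pi> \<pi>' :: "'a \<Rightarrow> ell2 \<Rightarrow>\<^sub>L ell2" assume R: "\<pi> \<in> Reps" "\<pi>' \<in> Reps"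
    have "norm (\<pi> (z *\<^sub>C a) - \<pi>' (z *\<^sub>C a)) \<le> cmod z * norm (\<pi> a - \<pi>' a)"
    proof (rule norm_blinfun_bound)
      fix x
      have "z *\<^sub>C v - z *\<^sub>C w = z *\<^sub>C (v - w)" for v w :: ell2
        by transfer (simp add: right_diff_distrib)
      then have "norm ((\<pi> (z *\<^sub>C a) - \<pi>' (z *\<^sub>C a)) x) = cmod z * norm ((\<pi> a - \<pi>' a) x)"
        by (simp add: minus_blinfun.rep_eq Reps_scaleC R norm_scaleC_ell2)
      also have "\<dots> \<le> cmod z * (norm (\<pi> a - \<pi>' a) * norm x)"
        by (intro mult_left_mono norm_blinfun) simp
      finally show "norm ((\<pi> (z *\<^sub>C a) - \<pi>' (z *\<^sub>C a)) x) \<le> cmod z * norm (\<pi> a - \<pi>' a) * norm x"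
        by (simp add: mult.assoc)
    qed simp
    then show "norm (\<pi> (z *\<^sub>C a) - \<pi>' (z *\<^sub>C a))
        \<le> cmod z * norm (\<pi> a - \<pi>' a) + 0 * norm (\<pi> a - \<pi>' a)" by simp
  qed auto
  moreover have "unif_cont_elem K (star a)" if "unif_cont_elem K a" for a
  proof (rule I[OF that that, of 1 0])
    fix \<pi> \<pi>' :: "'a \<Rightarrow> ell2 \<Rightarrow>\<^sub>L ell2" assume R: "\<pi> \<in> Reps" "\<pi>' \<in> Reps"
    have "norm (\<pi> (star a) - \<pi>' (star a)) \<le> norm (\<pi> a - \<pi>' a)"
      by (rule norm_adjoint_le)
        (simp add: minus_blinfun.rep_eq inner_diff_left inner_diff_right Reps_star R)
    then show "norm (\<pi> (star a) - \<pi>' (star a))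
        \<le> 1 * norm (\<pi> a - \<pi>' a) + 0 * norm (\<pi> a - \<pi>' a)" by simp
  qed auto
  ultimately show ?thesis by (simp add: cstar_subalgebra_def)
qed

lemma generates_imp_unif_cont_elem:
  assumes "bounded K" "generates K"
  shows "unif_cont_elem K a"
proof -
  have "unif_cont_elem K 1"
    by (rule unif_cont_elemI) (auto simp: Reps_one intro!: exI[of _ 0])
  moreover have "unif_cont_elem K x" if "x \<in> K" for x
  proof (rule unif_cont_elemI, intro exI[of _ 1] conjI ballI)
    fix \<epsilon> :: real and \<pi> \<pi>' :: "'a \<Rightarrow> ell2 \<Rightarrow>\<^sub>L ell2"
    assume "\<epsilon> > 0" "\<pi> \<in> Reps" "\<pi>' \<in> Reps"
    then show "norm (\<pi> x - \<pi>' x) \<le> 1 * dist_rep K \<pi> \<pi>' + \<epsilon>"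
      using dist_rep_upper[OF assms(1) _ _ that, of \<pi> \<pi>'] by simp
  qed simp
  ultimately have "cstar_subalgebra hull (insert 1 K) \<subseteq> {a. unif_cont_elem K a}"
    by (intro hull_minimal cstar_subalgebra_unif_cont_elem) auto
  then show ?thesis using assms(2) unfolding generates_def by auto
qed

section \<open>Concave majorants\<close>

text \<open>
  The majorant is the infimum of all increasing affine majorants. It is concave, hence continuous
  on the open half line; continuity at \<open>0\<close> needs affine majorants with arbitrarily small value there.
\<close>

lemma ex_Omega_majorant_affine:
  fixes f :: "real \<Rightarrow> real"
  assumes nonneg: "\<And>t. 0 \<le> t \<Longrightarrow> 0 \<le> f t"
    and affine: "\<And>\<epsilon>. \<epsilon> > 0 \<Longrightarrow> \<exists>m\<ge>0. \<forall>t\<ge>0. f t \<le> m * t + \<epsilon>"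
  shows "\<exists>\<omega>\<in>Omega. \<forall>t\<ge>0. f t \<le> \<omega> t"
proof -
  define A where "A = {(m, c). m \<ge> 0 \<and> c \<ge> 0 \<and> (\<forall>t\<ge>0. f t \<le> m * t + c)}"
  define g where "g t = (INF (m, c)\<in>A. m * t + c)" for t
  obtain m where "m \<ge> 0" "\<forall>t\<ge>0. f t \<le> m * t + 1" using affine[of 1] by auto
  then have "(m, 1) \<in> A" by (simp add: A_def)
  then have A_ne: "A \<noteq> {}" by blast
  have g_le: "g t \<le> m * t + c" if "(m, c) \<in> A" "t \<ge> 0" for m c t
    unfolding g_def using that
    by (intro cINF_lower2[OF _ that(1)] bdd_belowI2[of _ 0]) (auto simp: A_def)
  have le_g: "x \<le> g t" if "\<And>m c. (m, c) \<in> A \<Longrightarrow> x \<le> m * t + c" for x t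
    unfolding g_def using that by (intro cINF_greatest[OF A_ne]) auto
  have g_nonneg: "0 \<le> g t" if "t \<ge> 0" for t
    using that by (intro le_g) (auto simp: A_def)
  have concave: "concave_on {0..} g"
    unfolding concave_on_iff
  proof (intro conjI ballI allI impI)
    fix x y u v :: real assume H: "x \<in> {0..}" "y \<in> {0..}" "0 \<le> u" "0 \<le> v" "u + v = 1"
    show "u * g x + v * g y \<le> g (u *\<^sub>R x + v *\<^sub>R y)"
    proof (rule le_g)
      fix m c assume mc: "(m, c) \<in> A"
      have "u * g x + v * g y \<le> u * (m * x + c) + v * (m * y + c)"
        using H by (intro add_mono mult_left_mono g_le[OF mc]) auto
      also have "\<dots> = m * (u * x + v * y) + (u + v) * c" by (simp add: algebra_simps)
      finally show "u * g x + v * g y \<le> m * (u *\<^sub>R x + v *\<^sub>R y) + c" using H by simp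
    qed
  qed simp
  have mono: "mono_on {0..} g"
  proof (rule mono_onI)
    fix r s :: real assume rs: "r \<in> {0..}" "s \<in> {0..}" "r \<le> s"
    show "g r \<le> g s"
    proof (rule le_g)
      fix m c assume mc: "(m, c) \<in> A"
      then have "m * r \<le> m * s" using rs by (auto simp: A_def intro: mult_left_mono)
      then show "g r \<le> m * s + c" using g_le[OF mc, of r] rs by simp
    qed
  qed
  have small: "\<exists>m\<ge>0. \<forall>t\<ge>0. g t \<le> m * t + \<epsilon>" if \<epsilon>: "\<epsilon> > 0" for \<epsilon>
  proof -
    obtain m where "m \<ge> 0" "\<forall>t\<ge>0. f t \<le> m * t + \<epsilon>" using affine[OF \<epsilon>] by blast
    then show ?thesis using \<epsilon> g_le[of m \<epsilon>] by (auto simp: A_def)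
  qed
  have "g 0 \<le> 0"
  proof (rule field_le_epsilon)
    fix e :: real assume "e > 0"
    from small[OF this] show "g 0 \<le> 0 + e" by auto
  qed
  with g_nonneg[of 0] have g0: "g 0 = 0" by simp
  have cont_open: "continuous_on {0<..} g"
  proof -
    have "convex_on {0<..} (\<lambda>x. - g x)"
      using concave unfolding concave_on_def by (rule convex_on_subset) auto
    then have "continuous_on {0<..} (\<lambda>x. - g x)" by (intro convex_on_continuous) auto
    then show ?thesis using continuous_on_minus[of "{0<..}" "\<lambda>x. - g x"] by simp
  qed
  have cont_pos: "continuous (at t within {0..}) g" if t: "t > 0" for t
  proof (rule continuous_at_imp_continuous_at_within)
    show "isCont g t"
      by (rule continuous_on_interior[OF cont_open]) (simp add: interior_open t)
  qed
  have cont_0: "continuous (at 0 within {0..}) g"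
    unfolding continuous_within_eps_delta
  proof (intro allI impI)
    fix e :: real assume e: "e > 0"
    then obtain m where m: "m \<ge> 0" "\<forall>t\<ge>0. g t \<le> m * t + e / 2" using small[of "e / 2"] by auto
    show "\<exists>d>0. \<forall>x'\<in>{0..}. dist x' 0 < d \<longrightarrow> dist (g x') (g 0) < e"
    proof (intro exI[of _ "e / (2 * (m + 1))"] conjI ballI impI)
      show "0 < e / (2 * (m + 1))" using e m by simp
      fix t :: real assume t: "t \<in> {0..}" "dist t 0 < e / (2 * (m + 1))"
      have "m * t \<le> (m + 1) * t" using t by (simp add: algebra_simps)
      also have "\<dots> < e / 2" using t m by (simp add: field_simps)
      finally have "g t < e" using m(2)[rule_format, of t] t by simp
      then show "dist (g t) (g 0) < e" using t g_nonneg[of t] g0 by (simp add: dist_real_def)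
    qed
  qed
  have "continuous_on {0..} g"
    unfolding continuous_on_eq_continuous_within
    using cont_pos cont_0 by (auto simp: less_eq_real_def)
  then have "g \<in> Omega" using concave mono g0 g_nonneg by (simp add: Omega_def)
  moreover have "f t \<le> g t" if "t \<ge> 0" for t
    using that by (intro le_g) (auto simp: A_def)
  ultimately show ?thesis by blast
qed

lemma ex_Omega_majorant:
  assumes "bounded K" "generates K"
  shows "\<exists>\<omega>\<in>Omega. \<forall>t\<ge>0. osc K a t \<le> \<omega> t"
proof (rule ex_Omega_majorant_affine)
  show "0 \<le> osc K a t" for t by (rule osc_nonneg)
  fix \<epsilon> :: real assume \<epsilon>: "\<epsilon> > 0"
  obtain m where m: "m \<ge> 0"
    "\<And>\<pi> \<pi>'. \<pi> \<in> Reps \<Longrightarrow> \<pi>' \<in> Reps \<Longrightarrow> norm (\<pi> a - \<pi>' a) \<le> m * dist_rep K \<pi> \<pi>' + \<epsilon>"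
    by (rule unif_cont_elemE[OF generates_imp_unif_cont_elem[OF assms, of a] \<epsilon>]) blast
  have "osc K a t \<le> m * t + \<epsilon>" if t: "t \<ge> 0" for t
  proof (rule osc_least)
    fix \<pi> \<pi>' :: "'a \<Rightarrow> ell2 \<Rightarrow>\<^sub>L ell2"
    assume R: "\<pi> \<in> Reps" "\<pi>' \<in> Reps" "dist_rep K \<pi> \<pi>' \<le> t"
    have "norm (\<pi> a - \<pi>' a) \<le> m * dist_rep K \<pi> \<pi>' + \<epsilon>" by (rule m(2)[OF R(1,2)])
    also have "\<dots> \<le> m * t + \<epsilon>" using R m by (simp add: mult_left_mono)
    finally show "norm (\<pi> a - \<pi>' a) \<le> m * t + \<epsilon>" .
  qed (use t m \<epsilon> in simp)
  with m(1) show "\<exists>m\<ge>0. \<forall>t\<ge>0. osc K a t \<le> m * t + \<epsilon>" by blast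
qed

lemma Omega_nonneg: "\<omega> \<in> Omega \<Longrightarrow> t \<ge> 0 \<Longrightarrow> 0 \<le> \<omega> t"
  by (simp add: Omega_def)

lemma Omega_mono: "\<omega> \<in> Omega \<Longrightarrow> 0 \<le> s \<Longrightarrow> s \<le> t \<Longrightarrow> \<omega> s \<le> \<omega> t"
  by (rule mono_onD[of "{0..}" \<omega>]) (simp_all add: Omega_def)

lemma Omega_concave:
  assumes "\<omega> \<in> Omega" "0 \<le> x" "0 \<le> y" "0 \<le> u" "0 \<le> v" "u + v = 1"
  shows "u * \<omega> x + v * \<omega> y \<le> \<omega> (u * x + v * y)"
proof -
  have "concave_on {0..} \<omega>" using assms(1) by (simp add: Omega_def)
  then show ?thesis
    using assms(2-6) unfolding concave_on_iff by (metis atLeast_iff real_scaleR_def)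
qed

lemma id_in_Omega: "(\<lambda>t. t) \<in> Omega"
  by (simp add: Omega_def concave_on_iff mono_on_def)

lemma Omega_comp:
  assumes f: "f \<in> Omega" and g: "g \<in> Omega"
  shows "(\<lambda>t. f (g t)) \<in> Omega"
proof -
  have "continuous_on {0..} f" "continuous_on {0..} g" using f g by (simp_all add: Omega_def)
  moreover have "g ` {0..} \<subseteq> {0..}" using Omega_nonneg[OF g] by auto
  ultimately have "continuous_on {0..} (\<lambda>t. f (g t))" by (rule continuous_on_compose2)
  moreover have "concave_on {0..} (\<lambda>t. f (g t))"
    unfolding concave_on_iff
  proof (intro conjI ballI allI impI)
    fix x y u v :: real assume H: "x \<in> {0..}" "y \<in> {0..}" "0 \<le> u" "0 \<le> v" "u + v = 1"
    then have H': "0 \<le> x" "0 \<le> y" by auto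
    have "u * f (g x) + v * f (g y) \<le> f (u * g x + v * g y)"
      by (rule Omega_concave[OF f Omega_nonneg[OF g H'(1)] Omega_nonneg[OF g H'(2)] H(3-5)])
    also have "\<dots> \<le> f (g (u * x + v * y))"
      using Omega_nonneg[OF g H'(1)] Omega_nonneg[OF g H'(2)] H(3,4)
      by (intro Omega_mono[OF f] Omega_concave[OF g H' H(3-5)]) simp
    finally show "u * f (g x) + v * f (g y) \<le> f (g (u *\<^sub>R x + v *\<^sub>R y))" by simp
  qed simp
  moreover have "mono_on {0..} (\<lambda>t. f (g t))"
    by (rule mono_onI) (simp add: Omega_mono[OF f] Omega_mono[OF g] Omega_nonneg[OF g])
  ultimately show ?thesis
    using f g by (simp add: Omega_def)
qed

section \<open>Moduli of elements and of homomorphisms\<close>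

lemma omega_elem_le:
  assumes "\<omega> \<in> Omega" "\<And>s. s \<ge> 0 \<Longrightarrow> osc K a s \<le> \<omega> s" "t \<ge> 0"
  shows "omega_elem K a t \<le> \<omega> t"
  unfolding omega_elem_def using assms
  by (intro cInf_lower bdd_belowI[of _ 0]) (auto simp: Omega_nonneg)

lemma le_omega_elem:
  assumes "bounded K" "generates K"
    and "\<And>\<omega>. \<omega> \<in> Omega \<Longrightarrow> \<forall>s\<ge>0. osc K a s \<le> \<omega> s \<Longrightarrow> x \<le> \<omega> t"
  shows "x \<le> omega_elem K a t"
  unfolding omega_elem_def using assms ex_Omega_majorant[OF assms(1,2), of a]
  by (intro cInf_greatest) auto

lemma osc_le_omega_elem:
  assumes "bounded K" "generates K" "t \<ge> 0"
  shows "osc K a t \<le> omega_elem K a t"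
  using assms by (intro le_omega_elem) auto

lemma omega_elem_generator_le:
  assumes "bounded K" "x \<in> K" "t \<ge> 0"
  shows "omega_elem K x t \<le> t"
proof (rule omega_elem_le[OF id_in_Omega _ assms(3)])
  fix s :: real assume "s \<ge> 0"
  then show "osc K x s \<le> s"
    by (rule osc_least) (rule order_trans[OF dist_rep_upper[OF assms(1) _ _ assms(2)]])
qed

lemma Reps_comp:
  assumes "\<pi> \<in> Reps" "unital_star_hom \<alpha>"
  shows "\<pi> \<circ> \<alpha> \<in> Reps"
  using assms by (simp add: Reps_def unital_star_hom_def)

lemma modulus_conditions_equiv:
  fixes \<alpha> :: "'a::unital_cstar_algebra \<Rightarrow> 'b::unital_cstar_algebra"
  assumes K: "bounded K" "generates K" and L: "bounded L" "generates L"
    and \<alpha>: "unital_star_hom \<alpha>" and \<omega>: "\<omega> \<in> Omega"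
  shows "(\<forall>a. \<forall>s\<ge>0. omega_elem L (\<alpha> a) s \<le> omega_elem K a (\<omega> s)) \<longleftrightarrow>
    (\<forall>\<pi>\<in>Reps. \<forall>\<pi>'\<in>Reps. dist_rep K (\<pi> \<circ> \<alpha>) (\<pi>' \<circ> \<alpha>) \<le> \<omega> (dist_rep L \<pi> \<pi>'))"
    (is "?elem \<longleftrightarrow> ?pullback")
proof
  assume elem: ?elem
  show ?pullback
  proof (intro ballI)
    fix \<pi> \<pi>' :: "'b \<Rightarrow> ell2 \<Rightarrow>\<^sub>L ell2" assume R: "\<pi> \<in> Reps" "\<pi>' \<in> Reps"
    define d where "d = dist_rep L \<pi> \<pi>'"
    have d: "d \<ge> 0" unfolding d_def by (rule dist_rep_nonneg[OF L(1) R])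
    have \<omega>d: "\<omega> d \<ge> 0" by (rule Omega_nonneg[OF \<omega> d])
    show "dist_rep K (\<pi> \<circ> \<alpha>) (\<pi>' \<circ> \<alpha>) \<le> \<omega> (dist_rep L \<pi> \<pi>')"
      unfolding d_def[symmetric]
    proof (rule dist_rep_least[OF \<omega>d])
      fix x assume x: "x \<in> K"
      have "norm (\<pi> (\<alpha> x) - \<pi>' (\<alpha> x)) \<le> osc L (\<alpha> x) d"
        by (rule osc_upper[OF R]) (simp add: d_def)
      also have "\<dots> \<le> omega_elem L (\<alpha> x) d" by (rule osc_le_omega_elem[OF L d])
      also have "\<dots> \<le> omega_elem K x (\<omega> d)" using elem d by blast
      also have "\<dots> \<le> \<omega> d" by (rule omega_elem_generator_le[OF K(1) x \<omega>d])
      finally show "norm ((\<pi> \<circ> \<alpha>) x - (\<pi>' \<circ> \<alpha>) x) \<le> \<omega> d" by simp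
    qed
  qed
next
  assume pullback: ?pullback
  show ?elem
  proof (intro allI impI)
    fix a and s :: real assume s: "s \<ge> 0"
    show "omega_elem L (\<alpha> a) s \<le> omega_elem K a (\<omega> s)"
    proof (rule le_omega_elem[OF K])
      fix \<omega>' assume \<omega>': "\<omega>' \<in> Omega" "\<forall>s\<ge>0. osc K a s \<le> \<omega>' s"
      have "osc L (\<alpha> a) r \<le> \<omega>' (\<omega> r)" if r: "r \<ge> 0" for r
      proof (rule osc_least)
        show "0 \<le> \<omega>' (\<omega> r)" by (rule Omega_nonneg[OF \<omega>'(1) Omega_nonneg[OF \<omega> r]])
        fix \<pi> \<pi>' :: "'b \<Rightarrow> ell2 \<Rightarrow>\<^sub>L ell2"
        assume R: "\<pi> \<in> Reps" "\<pi>' \<in> Reps" "dist_rep L \<pi> \<pi>' \<le> r"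
        have "dist_rep K (\<pi> \<circ> \<alpha>) (\<pi>' \<circ> \<alpha>) \<le> \<omega> (dist_rep L \<pi> \<pi>')" using pullback R by blast
        also have "\<dots> \<le> \<omega> r" by (rule Omega_mono[OF \<omega> dist_rep_nonneg[OF L(1) R(1,2)] R(3)])
        finally have "norm ((\<pi> \<circ> \<alpha>) a - (\<pi>' \<circ> \<alpha>) a) \<le> osc K a (\<omega> r)"
          by (rule osc_upper[OF Reps_comp[OF R(1) \<alpha>] Reps_comp[OF R(2) \<alpha>]])
        also have "\<dots> \<le> \<omega>' (\<omega> r)" using \<omega>'(2) Omega_nonneg[OF \<omega> r] by blast
        finally show "norm (\<pi> (\<alpha> a) - \<pi>' (\<alpha> a)) \<le> \<omega>' (\<omega> r)" by simp
      qed
      then show "omega_elem L (\<alpha> a) s \<le> \<omega>' (\<omega> s)"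
        using omega_elem_le[OF Omega_comp[OF \<omega>'(1) \<omega>]] s by blast
    qed
  qed
qed

theorem fact6p6:
  fixes K :: "'a::unital_cstar_algebra set"
    and L :: "'b::unital_cstar_algebra set"
    and \<alpha> :: "'a \<Rightarrow> 'b"
  assumes "separable_space (euclidean :: 'a topology)"
    and "separable_space (euclidean :: 'b topology)"
    and "compact K" and "generates K"
    and "compact L" and "generates L"
    and "unital_star_hom \<alpha>"
  shows "\<forall>t\<ge>0. omega_hom K L \<alpha> t = omega_tilde_hom K L \<alpha> t"
proof -
  note equiv = modulus_conditions_equiv[OF compact_imp_bounded[OF assms(3)] assms(4)
      compact_imp_bounded[OF assms(5)] assms(6,7)]
  show ?thesis
    unfolding omega_hom_def omega_tilde_hom_def by (simp add: equiv cong: conj_cong)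
qed

end
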